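(* Let $\mathcal{P}$ and $\mathcal{P}'$ be parameterized programs such that $\mathcal{P}\subseteq\mathcal{P}'$ and every program of $\mathcal{P}'$ is a subprogram of some program in $\mathcal{P}$. Then $\mathcal{P}$ is safe if and only if $\mathcal{P}'$ is safe. If furthermore $\mathbb{T}$ is a universal structure for both $\mathcal{P}$ and $\mathcal{P}'$, then any $\mathbb{T}$-proof space $\mathcal{H}$ proves the safety of $\mathcal{P}$ if and only if it proves the safety of $\mathcal{P}'$.
   Context: For a structure and a set $V$ of elements, $N(V)$ is the substructure generated by $V$; $N(\vec a)$ that of the entries of tuple $\vec a$; juxtaposition of tuples is concatenation. A local isomorphism from $\vec a$ to $\vec b$ (same length) is an isomorphism $\beta:N(\vec a)\to N(\vec b)$ with $\beta(\vec a)=\vec b$; $\vec a\simeq\vec b$ if one exists. Programs. Fix a vocabulary $\mathcal{V}_{\mathsf{Node}}$, a data domain $\mathbb{D}$ (structure over vocabulary $\mathcal{V}_{\mathsf{Data}}$), a finite command set $\Sigma$, a finite location set $\mathbf{L}$ with distinguished $l_{\mathrm{init}},l_{\mathrm{err}}$, and $\mathsf{src},\mathsf{tgt}:\Sigma\to\mathbf{L}$. A topology is a $\mathcal{V}_{\mathsf{Node}}$-structure. A program over topology $\mathbb{T}$ is $(P,[\![-]\!])$ with $P:\mathbb{T}\to2^\Sigma$ and relations $[\![\sigma:v]\!]\subseteq(N(v)\to\mathbb{D})^2$ for $\langle\sigma:v\rangle\in\Sigma\times\mathbb{T}$. For location maps, $\lambda\xrightarrow{\sigma:v}\lambda'$ iff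 $\sigma\in P(v)$, $\lambda(v)=\mathsf{src}(\sigma)$, and $\lambda'$ is $\lambda$ with $v$ reassigned to $\mathsf{tgt}(\sigma)$. Error runs $\mathcal{L}_{\mathrm{err}}(P)$: words $\langle\sigma_1:a_1\rangle\cdots\langle\sigma_n:a_n\rangle$ admitting location maps $\lambda_0\equiv l_{\mathrm{init}}$, $\lambda_{r-1}\xrightarrow{\sigma_r:a_r}\lambda_r$, with $l_{\mathrm{err}}$ in the range of $\lambda_n$. For $V\supseteq N(v)$, $\mathsf{Global}_V[\![\sigma:v]\!]$ is the set of pairs of valuations $V\to\mathbb{D}$ whose restrictions to $N(v)$ are in $[\![\sigma:v]\!]$ and which agree outside $N(v)$; extended to words by composition. A run $\rho$ is infeasible if $\mathsf{Global}_{\mathbb{T}}[\![\rho]\!]=\emptyset$; a program is safe if every error run is infeasible. For a substructure $\mathbb{S}$ of $\mathbb{T}$, the subprogram of $(P,[\![-]\!])$ over $\mathbb{S}$ is $(P|_{\mathbb{S}},[\![-]\!]|_{\Sigma\times\mathbb{S}})$. For a local isomorphism $\beta$, $\beta^*\nu=\nu\circ\beta$ (lifted to pairs and sets). A parameterized program is a family (set) of programs $\mathbf{P}_i=(P_i,[\![-]\!]_i)$ over topologies $\mathbb{T}_i$ (common $\mathcal{V}_{\mathsf{Node}},\mathbb{D},\Sigma,\mathbf{L}$) such that for $a\in\mathbb{T}_i$, $a'\in\mathbb{T}_j$ and local isomorphism $\beta$ from $a$ to $a'$: $P_i(a)=P_j(a')$ and $[\![\sigma:a]\!]_i=\beta^*[\![\sigma:a']\!]_j$.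 It is safe if every member is safe. A universal structure is a $\mathcal{V}_{\mathsf{Node}}$-structure $\mathbb{T}$ into which every $\mathbb{T}_i$ embeds, each $\mathbb{T}_i$ being identified with a substructure of $\mathbb{T}$. Semantics on $\mathbb{T}$: $[\![\sigma:v]\!]=\beta^*[\![\sigma:u]\!]_i$ if some $u\in\mathbb{T}_i$ and local isomorphism $\beta$ from $v$ to $u$ exist, else $\emptyset$. Hoare triples and proof spaces. Assertions: $\phi[\mu(u_1),\dots,\mu(u_m)]$ with $\phi$ a $\mathcal{V}_{\mathsf{Data}}$-formula, $u_j\in\mathbb{T}$; $\nu$ satisfies it if $\mathbb{D}\models\phi[\nu(u_1),\dots,\nu(u_m)]$. A triple $\{\phi[\overrightarrow{\mu(u)}]\}\rho\{\psi[\overrightarrow{\mu(w)}]\}$, $\rho=\langle\sigma_1:v_1\rangle\cdots\langle\sigma_n:v_n\rangle$, is valid if for $V=N(\vec u\vec v\vec w)$ every $(\nu,\nu')\in\mathsf{Global}_V[\![\rho]\!]$ with $\nu$ satisfying the precondition has $\nu'$ satisfying the postcondition. Rules (assertions as conjunctions of conjuncts): Sequencing — from $\{A_1\}\rho_1\{A_2\}$, $\{A_2'\}\rho_2\{A_3\}$ with each conjunct of $A_2'$ a conjunct of $A_2$, derive $\{A_1\}\rho_1\rho_2\{A_3\}$; Conjunction — from $\{A_1\}\rho\{B_1\}$, $\{A_2\}\rho\{B_2\}$ derive $\{A_1\wedge A_2\}\rho\{B_1\wedge B_2\}$; S-param — from a triple with node tuples $\vec u,\vec v,\vec w$ derive the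 triple with $\vec u',\vec v',\vec w'$ whenever lengths agree and $\vec u\vec v\vec w\simeq\vec u'\vec v'\vec w'$. A $\mathbb{T}$-proof space is a set of triples closed under these rules; valid if all its triples are valid; $\mathcal{L}(\mathcal{H})=\{\rho:\{\top\}\rho\{\bot\}\in\mathcal{H}\}$. $\mathcal{H}$ proves the safety of $\mathcal{P}=\{(P_i,[\![-]\!]_i)\}$ if $\mathcal{H}$ is valid and $\bigcup_i\mathcal{L}_{\mathrm{err}}(P_i)\subseteq\mathcal{L}(\mathcal{H})$. *)

theory Defs
  imports Main "HOL-Library.FuncSet"
begin

section \<open>First-order vocabularies and structures\<close>

text \<open>Constants are function symbols of arity 0. Interpretations are total HOL functions on lists;
  only their values on tuples of the right arity over the carrier are ever consulted.\<close>

record ('f, 'r) vocab =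
  fsyms :: "'f set"
  farity :: "'f \<Rightarrow> nat"
  rsyms :: "'r set"
  rarity :: "'r \<Rightarrow> nat"

record ('f, 'r, 'a) struct =
  carrier :: "'a set"
  fint :: "'f \<Rightarrow> 'a list \<Rightarrow> 'a"
  rint :: "'r \<Rightarrow> 'a list \<Rightarrow> bool"

definition tuples :: "'a set \<Rightarrow> nat \<Rightarrow> 'a list set" where
  "tuples A n = {xs. set xs \<subseteq> A \<and> length xs = n}"

definition wf_struct :: "('f, 'r) vocab \<Rightarrow> ('f, 'r, 'a) struct \<Rightarrow> bool" where
  "wf_struct voc M \<longleftrightarrow>
     (\<forall>f\<in>fsyms voc. \<forall>xs\<in>tuples (carrier M) (farity voc f). fint M f xs \<in> carrier M)"

definition embedding ::
  "('f, 'r) vocab \<Rightarrow> ('f, 'r, 'a) struct \<Rightarrow> ('f, 'r, 'b) struct \<Rightarrow> ('a \<Rightarrow> 'b) \<Rightarrow> bool" where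
  "embedding voc M M' h \<longleftrightarrow>
     inj_on h (carrier M) \<and> h ` carrier M \<subseteq> carrier M' \<and>
     (\<forall>f\<in>fsyms voc. \<forall>xs\<in>tuples (carrier M) (farity voc f).
        h (fint M f xs) = fint M' f (map h xs)) \<and>
     (\<forall>r\<in>rsyms voc. \<forall>xs\<in>tuples (carrier M) (rarity voc r).
        rint M r xs \<longleftrightarrow> rint M' r (map h xs))"

definition isomorphism ::
  "('f, 'r) vocab \<Rightarrow> ('f, 'r, 'a) struct \<Rightarrow> ('f, 'r, 'b) struct \<Rightarrow> ('a \<Rightarrow> 'b) \<Rightarrow> bool" where
  "isomorphism voc M M' h \<longleftrightarrow> embedding voc M M' h \<and> h ` carrier M = carrier M'"

definition substructure ::
  "('f, 'r) vocab \<Rightarrow> ('f, 'r, 'a) struct \<Rightarrow> ('f, 'r, 'a) struct \<Rightarrow> bool" where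
  "substructure voc S M \<longleftrightarrow>
     wf_struct voc S \<and> carrier S \<subseteq> carrier M \<and>
     (\<forall>f\<in>fsyms voc. \<forall>xs\<in>tuples (carrier S) (farity voc f). fint S f xs = fint M f xs) \<and>
     (\<forall>r\<in>rsyms voc. \<forall>xs\<in>tuples (carrier S) (rarity voc r). rint S r xs \<longleftrightarrow> rint M r xs)"

inductive_set generated ::
  "('f, 'r) vocab \<Rightarrow> ('f, 'r, 'a) struct \<Rightarrow> 'a set \<Rightarrow> 'a set"
  for voc :: "('f, 'r) vocab" and M :: "('f, 'r, 'a) struct" and X :: "'a set" where
  base: "x \<in> X \<Longrightarrow> x \<in> generated voc M X"
| app: "f \<in> fsyms voc \<Longrightarrow> length xs = farity voc f \<Longrightarrow>
    (\<forall>x\<in>set xs. x \<in> generated voc M X) \<Longrightarrow> fint M f xs \<in> generated voc M X"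

definition gen_struct ::
  "('f, 'r) vocab \<Rightarrow> ('f, 'r, 'a) struct \<Rightarrow> 'a set \<Rightarrow> ('f, 'r, 'a) struct" where
  "gen_struct voc M X = M\<lparr>carrier := generated voc M X\<rparr>"

definition local_iso ::
  "('f, 'r) vocab \<Rightarrow> ('f, 'r, 'a) struct \<Rightarrow> 'a list \<Rightarrow>
   ('f, 'r, 'b) struct \<Rightarrow> 'b list \<Rightarrow> ('a \<Rightarrow> 'b) \<Rightarrow> bool" where
  "local_iso voc M as M' bs \<beta> \<longleftrightarrow>
     set as \<subseteq> carrier M \<and> set bs \<subseteq> carrier M' \<and>
     isomorphism voc (gen_struct voc M (set as)) (gen_struct voc M' (set bs)) \<beta> \<and>
     map \<beta> as = bs"

definition locally_isomorphic ::
  "('f, 'r) vocab \<Rightarrow> ('f, 'r, 'a) struct \<Rightarrow> 'a list \<Rightarrow> 'a list \<Rightarrow> bool" where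
  "locally_isomorphic voc M as bs \<longleftrightarrow> (\<exists>\<beta>. local_iso voc M as M bs \<beta>)"


section \<open>First-order formulas\<close>

text \<open>Free variables are named by elements of a type \<open>'v\<close>; bound variables are de Bruijn
  indices into the environment \<open>bs\<close> of the evaluation functions.\<close>

datatype (tm_funs: 'g, tm_vars: 'v) tm =
  Var 'v | Bnd nat | Fn 'g "('g, 'v) tm list"

datatype (fm_funs: 'g, fm_rels: 's, fvars: 'v) fm =
  Top | Bot
| Eq "('g, 'v) tm" "('g, 'v) tm"
| Rel 's "('g, 'v) tm list"
| Neg "('g, 's, 'v) fm"
| And "('g, 's, 'v) fm" "('g, 's, 'v) fm"
| Or "('g, 's, 'v) fm" "('g, 's, 'v) fm"
| Imp "('g, 's, 'v) fm" "('g, 's, 'v) fm"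
| Forall "('g, 's, 'v) fm"
| Exists "('g, 's, 'v) fm"

primrec wf_tm :: "('g, 's) vocab \<Rightarrow> nat \<Rightarrow> ('g, 'v) tm \<Rightarrow> bool" where
  "wf_tm voc n (Var x) \<longleftrightarrow> True"
| "wf_tm voc n (Bnd i) \<longleftrightarrow> i < n"
| "wf_tm voc n (Fn f ts) \<longleftrightarrow>
     f \<in> fsyms voc \<and> length ts = farity voc f \<and> list_all (wf_tm voc n) ts"

primrec wf_fm :: "('g, 's) vocab \<Rightarrow> nat \<Rightarrow> ('g, 's, 'v) fm \<Rightarrow> bool" where
  "wf_fm voc n Top \<longleftrightarrow> True"
| "wf_fm voc n Bot \<longleftrightarrow> True"
| "wf_fm voc n (Eq s t) \<longleftrightarrow> wf_tm voc n s \<and> wf_tm voc n t"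
| "wf_fm voc n (Rel r ts) \<longleftrightarrow>
     r \<in> rsyms voc \<and> length ts = rarity voc r \<and> list_all (wf_tm voc n) ts"
| "wf_fm voc n (Neg A) \<longleftrightarrow> wf_fm voc n A"
| "wf_fm voc n (And A B) \<longleftrightarrow> wf_fm voc n A \<and> wf_fm voc n B"
| "wf_fm voc n (Or A B) \<longleftrightarrow> wf_fm voc n A \<and> wf_fm voc n B"
| "wf_fm voc n (Imp A B) \<longleftrightarrow> wf_fm voc n A \<and> wf_fm voc n B"
| "wf_fm voc n (Forall A) \<longleftrightarrow> wf_fm voc (Suc n) A"
| "wf_fm voc n (Exists A) \<longleftrightarrow> wf_fm voc (Suc n) A"

primrec eval_tm :: "('g, 's, 'd) struct \<Rightarrow> ('v \<Rightarrow> 'd) \<Rightarrow> 'd list \<Rightarrow> ('g, 'v) tm \<Rightarrow> 'd" where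
  "eval_tm D \<nu> bs (Var x) = \<nu> x"
| "eval_tm D \<nu> bs (Bnd i) = bs ! i"
| "eval_tm D \<nu> bs (Fn f ts) = fint D f (map (eval_tm D \<nu> bs) ts)"

primrec sat :: "('g, 's, 'd) struct \<Rightarrow> ('v \<Rightarrow> 'd) \<Rightarrow> 'd list \<Rightarrow> ('g, 's, 'v) fm \<Rightarrow> bool" where
  "sat D \<nu> bs Top \<longleftrightarrow> True"
| "sat D \<nu> bs Bot \<longleftrightarrow> False"
| "sat D \<nu> bs (Eq s t) \<longleftrightarrow> eval_tm D \<nu> bs s = eval_tm D \<nu> bs t"
| "sat D \<nu> bs (Rel r ts) \<longleftrightarrow> rint D r (map (eval_tm D \<nu> bs) ts)"
| "sat D \<nu> bs (Neg A) \<longleftrightarrow> \<not> sat D \<nu> bs A"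
| "sat D \<nu> bs (And A B) \<longleftrightarrow> sat D \<nu> bs A \<and> sat D \<nu> bs B"
| "sat D \<nu> bs (Or A B) \<longleftrightarrow> sat D \<nu> bs A \<or> sat D \<nu> bs B"
| "sat D \<nu> bs (Imp A B) \<longleftrightarrow> (sat D \<nu> bs A \<longrightarrow> sat D \<nu> bs B)"
| "sat D \<nu> bs (Forall A) \<longleftrightarrow> (\<forall>d\<in>carrier D. sat D \<nu> (d # bs) A)"
| "sat D \<nu> bs (Exists A) \<longleftrightarrow> (\<exists>d\<in>carrier D. sat D \<nu> (d # bs) A)"


section \<open>Programs\<close>

text \<open>The data fixed once and for all: both vocabularies, the data domain, the commands and the
  locations.\<close>

record ('f, 'r, 'g, 's, 'd, 'c, 'l) frame =
  node_voc :: "('f, 'r) vocab"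
  data_voc :: "('g, 's) vocab"
  data :: "('g, 's, 'd) struct"
  commands :: "'c set"
  locations :: "'l set"
  src :: "'c \<Rightarrow> 'l"
  tgt :: "'c \<Rightarrow> 'l"
  l_init :: 'l
  l_err :: 'l

definition wf_frame :: "('f, 'r, 'g, 's, 'd, 'c, 'l) frame \<Rightarrow> bool" where
  "wf_frame F \<longleftrightarrow>
     wf_struct (data_voc F) (data F) \<and>
     finite (commands F) \<and> finite (locations F) \<and>
     l_init F \<in> locations F \<and> l_err F \<in> locations F \<and>
     src F \<in> commands F \<rightarrow> locations F \<and> tgt F \<in> commands F \<rightarrow> locations F"

text \<open>A function with domain \<open>V\<close> is represented by its extensional representative, so that
  valuations \<open>V \<rightarrow> D\<close> are the elements of \<open>valuations F V\<close>.\<close>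

definition valuations :: "('f, 'r, 'g, 's, 'd, 'c, 'l) frame \<Rightarrow> 'n set \<Rightarrow> ('n \<Rightarrow> 'd) set" where
  "valuations F V = V \<rightarrow>\<^sub>E carrier (data F)"

type_synonym ('n, 'd, 'c) semantics = "'c \<Rightarrow> 'n \<Rightarrow> (('n \<Rightarrow> 'd) \<times> ('n \<Rightarrow> 'd)) set"

abbreviation gen ::
  "('f, 'r, 'g, 's, 'd, 'c, 'l) frame \<Rightarrow> ('f, 'r, 'n) struct \<Rightarrow> 'n set \<Rightarrow> 'n set" where
  "gen F \<equiv> generated (node_voc F)"

record ('f, 'r, 'n, 'd, 'c) program =
  topology :: "('f, 'r, 'n) struct"
  cmds :: "'n \<Rightarrow> 'c set"
  sem :: "('n, 'd, 'c) semantics"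

definition wf_program ::
  "('f, 'r, 'g, 's, 'd, 'c, 'l) frame \<Rightarrow> ('f, 'r, 'n, 'd, 'c) program \<Rightarrow> bool" where
  "wf_program F p \<longleftrightarrow>
     wf_struct (node_voc F) (topology p) \<and>
     (\<forall>v\<in>carrier (topology p). cmds p v \<subseteq> commands F) \<and>
     (\<forall>\<sigma>\<in>commands F. \<forall>v\<in>carrier (topology p).
        sem p \<sigma> v \<subseteq> valuations F (gen F (topology p) {v}) \<times> valuations F (gen F (topology p) {v}))"

definition loc_step ::
  "('f, 'r, 'g, 's, 'd, 'c, 'l) frame \<Rightarrow> ('f, 'r, 'n, 'd, 'c) program \<Rightarrow>
   ('n \<Rightarrow> 'l) \<Rightarrow> 'c \<times> 'n \<Rightarrow> ('n \<Rightarrow> 'l) \<Rightarrow> bool" where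
  "loc_step F p lm a lm' \<longleftrightarrow>
     (case a of (\<sigma>, v) \<Rightarrow>
        v \<in> carrier (topology p) \<and> \<sigma> \<in> cmds p v \<and> lm v = src F \<sigma> \<and> lm' = lm(v := tgt F \<sigma>))"

definition error_runs ::
  "('f, 'r, 'g, 's, 'd, 'c, 'l) frame \<Rightarrow> ('f, 'r, 'n, 'd, 'c) program \<Rightarrow> ('c \<times> 'n) list set" where
  "error_runs F p =
     {\<rho>. \<exists>lm :: nat \<Rightarrow> 'n \<Rightarrow> 'l.
        (\<forall>k\<le>length \<rho>. lm k \<in> carrier (topology p) \<rightarrow>\<^sub>E locations F) \<and>
        lm 0 = (\<lambda>v\<in>carrier (topology p). l_init F) \<and>
        (\<forall>k<length \<rho>. loc_step F p (lm k) (\<rho> ! k) (lm (Suc k))) \<and>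
        l_err F \<in> lm (length \<rho>) ` carrier (topology p)}"

definition global_step ::
  "('f, 'r, 'g, 's, 'd, 'c, 'l) frame \<Rightarrow> ('f, 'r, 'n) struct \<Rightarrow> ('n, 'd, 'c) semantics \<Rightarrow>
   'n set \<Rightarrow> 'c \<times> 'n \<Rightarrow> (('n \<Rightarrow> 'd) \<times> ('n \<Rightarrow> 'd)) set" where
  "global_step F M s V a =
     (case a of (\<sigma>, v) \<Rightarrow>
        {(\<nu>, \<nu>'). \<nu> \<in> valuations F V \<and> \<nu>' \<in> valuations F V \<and>
           (restrict \<nu> (gen F M {v}), restrict \<nu>' (gen F M {v})) \<in> s \<sigma> v \<and>
           (\<forall>x\<in>V - gen F M {v}. \<nu> x = \<nu>' x)})"

primrec global ::
  "('f, 'r, 'g, 's, 'd, 'c, 'l) frame \<Rightarrow> ('f, 'r, 'n) struct \<Rightarrow> ('n, 'd, 'c) semantics \<Rightarrow>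
   'n set \<Rightarrow> ('c \<times> 'n) list \<Rightarrow> (('n \<Rightarrow> 'd) \<times> ('n \<Rightarrow> 'd)) set" where
  "global F M s V [] = Id_on (valuations F V)"
| "global F M s V (a # \<rho>) = global_step F M s V a O global F M s V \<rho>"

definition infeasible ::
  "('f, 'r, 'g, 's, 'd, 'c, 'l) frame \<Rightarrow> ('f, 'r, 'n, 'd, 'c) program \<Rightarrow> ('c \<times> 'n) list \<Rightarrow> bool" where
  "infeasible F p \<rho> \<longleftrightarrow> global F (topology p) (sem p) (carrier (topology p)) \<rho> = {}"

definition safe ::
  "('f, 'r, 'g, 's, 'd, 'c, 'l) frame \<Rightarrow> ('f, 'r, 'n, 'd, 'c) program \<Rightarrow> bool" where
  "safe F p \<longleftrightarrow> (\<forall>\<rho>\<in>error_runs F p. infeasible F p \<rho>)"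

text \<open>Programs are compared on their topology only; values of \<open>cmds\<close> and \<open>sem\<close> at other nodes, or
  of \<open>sem\<close> at other commands, carry no information.\<close>

definition subprogram ::
  "('f, 'r, 'g, 's, 'd, 'c, 'l) frame \<Rightarrow> ('f, 'r, 'n, 'd, 'c) program \<Rightarrow>
   ('f, 'r, 'n, 'd, 'c) program \<Rightarrow> bool" where
  "subprogram F q p \<longleftrightarrow>
     substructure (node_voc F) (topology q) (topology p) \<and>
     (\<forall>v\<in>carrier (topology q). cmds q v = cmds p v) \<and>
     (\<forall>\<sigma>\<in>commands F. \<forall>v\<in>carrier (topology q). sem q \<sigma> v = sem p \<sigma> v)"


section \<open>Parameterized programs and universal structures\<close>

text \<open>\<open>pullback A \<beta> R\<close> is \<open>\<beta>\<^sup>* R\<close> for \<open>\<beta>\<close> with domain \<open>A\<close>.\<close>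

definition pullback ::
  "'a set \<Rightarrow> ('a \<Rightarrow> 'b) \<Rightarrow> (('b \<Rightarrow> 'd) \<times> ('b \<Rightarrow> 'd)) set \<Rightarrow> (('a \<Rightarrow> 'd) \<times> ('a \<Rightarrow> 'd)) set" where
  "pullback A \<beta> R = (\<lambda>(\<nu>, \<nu>'). (compose A \<nu> \<beta>, compose A \<nu>' \<beta>)) ` R"

definition parameterized_program ::
  "('f, 'r, 'g, 's, 'd, 'c, 'l) frame \<Rightarrow> ('f, 'r, 'n, 'd, 'c) program set \<Rightarrow> bool" where
  "parameterized_program F P \<longleftrightarrow>
     (\<forall>p\<in>P. wf_program F p) \<and>
     (\<forall>p\<in>P. \<forall>q\<in>P. \<forall>a\<in>carrier (topology p). \<forall>a'\<in>carrier (topology q). \<forall>\<beta>.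
        local_iso (node_voc F) (topology p) [a] (topology q) [a'] \<beta> \<longrightarrow>
        cmds p a = cmds q a' \<and>
        (\<forall>\<sigma>\<in>commands F. sem p \<sigma> a = pullback (gen F (topology p) {a}) \<beta> (sem q \<sigma> a')))"

definition safe_family ::
  "('f, 'r, 'g, 's, 'd, 'c, 'l) frame \<Rightarrow> ('f, 'r, 'n, 'd, 'c) program set \<Rightarrow> bool" where
  "safe_family F P \<longleftrightarrow> (\<forall>p\<in>P. safe F p)"

text \<open>The identification of the topology of each member \<open>p\<close> with a substructure of \<open>T\<close> is made
  explicit as an embedding \<open>e p\<close>.\<close>

definition universal_structure ::
  "('f, 'r, 'g, 's, 'd, 'c, 'l) frame \<Rightarrow> ('f, 'r, 't) struct \<Rightarrow>
   ('f, 'r, 'n, 'd, 'c) program set \<Rightarrow> (('f, 'r, 'n, 'd, 'c) program \<Rightarrow> 'n \<Rightarrow> 't) \<Rightarrow> bool" where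
  "universal_structure F T P e \<longleftrightarrow>
     wf_struct (node_voc F) T \<and> (\<forall>p\<in>P. embedding (node_voc F) (topology p) T (e p))"

text \<open>For a parameterized program the choice of \<open>p\<close>, \<open>u\<close>, \<open>\<beta>\<close> is immaterial, so the union below is
  \<open>\<beta>\<^sup>*\<close> of the semantics at any locally isomorphic node, and empty if there is none; see
  \<open>universal_sem_eq\<close> and \<open>universal_sem_empty\<close>.\<close>

definition universal_sem ::
  "('f, 'r, 'g, 's, 'd, 'c, 'l) frame \<Rightarrow> ('f, 'r, 't) struct \<Rightarrow>
   ('f, 'r, 'n, 'd, 'c) program set \<Rightarrow> ('t, 'd, 'c) semantics" where
  "universal_sem F T P \<sigma> v =
     \<Union> {pullback (gen F T {v}) \<beta> (sem p \<sigma> u) | p u \<beta>.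
          p \<in> P \<and> u \<in> carrier (topology p) \<and>
          local_iso (node_voc F) T [v] (topology p) [u] \<beta>}"


section \<open>Hoare triples and proof spaces\<close>

text \<open>An assertion is a data formula whose free variables are nodes, the variable \<open>u\<close> standing for
  \<open>\<mu>(u)\<close>. \<open>inst \<phi> us\<close> is \<open>\<phi>[\<mu>(u\<^sub>1), \<dots>, \<mu>(u\<^sub>m)]\<close> for a formula \<open>\<phi>\<close> with positional free
  variables, numbered from 0.\<close>

definition inst :: "('g, 's, nat) fm \<Rightarrow> 't list \<Rightarrow> ('g, 's, 't) fm" where
  "inst \<phi> us = map_fm id id (\<lambda>i. us ! i) \<phi>"

fun conjuncts :: "('g, 's, 't) fm \<Rightarrow> ('g, 's, 't) fm set" where
  "conjuncts (And A B) = conjuncts A \<union> conjuncts B"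
| "conjuncts A = {A}"

type_synonym ('g, 's, 't, 'c) triple =
  "('g, 's, 't) fm \<times> ('c \<times> 't) list \<times> ('g, 's, 't) fm"

definition triples ::
  "('f, 'r, 'g, 's, 'd, 'c, 'l) frame \<Rightarrow> ('f, 'r, 't) struct \<Rightarrow> ('g, 's, 't, 'c) triple set" where
  "triples F T =
     {(A, \<rho>, B). wf_fm (data_voc F) 0 A \<and> fvars A \<subseteq> carrier T \<and>
        wf_fm (data_voc F) 0 B \<and> fvars B \<subseteq> carrier T \<and>
        set \<rho> \<subseteq> commands F \<times> carrier T}"

definition valid_triple ::
  "('f, 'r, 'g, 's, 'd, 'c, 'l) frame \<Rightarrow> ('f, 'r, 't) struct \<Rightarrow> ('t, 'd, 'c) semantics \<Rightarrow>
   ('g, 's, 't, 'c) triple \<Rightarrow> bool" where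
  "valid_triple F T s h \<longleftrightarrow>
     (case h of (A, \<rho>, B) \<Rightarrow>
        \<forall>(\<nu>, \<nu>') \<in> global F T s (gen F T (fvars A \<union> snd ` set \<rho> \<union> fvars B)) \<rho>.
          sat (data F) \<nu> [] A \<longrightarrow> sat (data F) \<nu>' [] B)"

definition closed_sequencing :: "('g, 's, 't, 'c) triple set \<Rightarrow> bool" where
  "closed_sequencing H \<longleftrightarrow>
     (\<forall>A1 \<rho>1 A2 A2' \<rho>2 A3.
        (A1, \<rho>1, A2) \<in> H \<and> (A2', \<rho>2, A3) \<in> H \<and> conjuncts A2' \<subseteq> conjuncts A2 \<longrightarrow>
        (A1, \<rho>1 @ \<rho>2, A3) \<in> H)"

definition closed_conjunction :: "('g, 's, 't, 'c) triple set \<Rightarrow> bool" where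
  "closed_conjunction H \<longleftrightarrow>
     (\<forall>A1 B1 A2 B2 \<rho>.
        (A1, \<rho>, B1) \<in> H \<and> (A2, \<rho>, B2) \<in> H \<longrightarrow> (And A1 A2, \<rho>, And B1 B2) \<in> H)"

definition closed_s_param ::
  "('f, 'r) vocab \<Rightarrow> ('f, 'r, 't) struct \<Rightarrow> ('g, 's, 't, 'c) triple set \<Rightarrow> bool" where
  "closed_s_param voc T H \<longleftrightarrow>
     (\<forall>\<phi> \<psi> \<sigma>s us vs ws us' vs' ws'.
        (inst \<phi> us, zip \<sigma>s vs, inst \<psi> ws) \<in> H \<and>
        fvars \<phi> \<subseteq> {..<length us} \<and> fvars \<psi> \<subseteq> {..<length ws} \<and> length \<sigma>s = length vs \<and>
        length us' = length us \<and> length vs' = length vs \<and> length ws' = length ws \<and>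
        locally_isomorphic voc T (us @ vs @ ws) (us' @ vs' @ ws') \<longrightarrow>
        (inst \<phi> us', zip \<sigma>s vs', inst \<psi> ws') \<in> H)"

definition proof_space ::
  "('f, 'r, 'g, 's, 'd, 'c, 'l) frame \<Rightarrow> ('f, 'r, 't) struct \<Rightarrow> ('g, 's, 't, 'c) triple set \<Rightarrow> bool" where
  "proof_space F T H \<longleftrightarrow>
     H \<subseteq> triples F T \<and> closed_sequencing H \<and> closed_conjunction H \<and>
     closed_s_param (node_voc F) T H"

definition lang :: "('g, 's, 't, 'c) triple set \<Rightarrow> ('c \<times> 't) list set" where
  "lang H = {\<rho>. (Top, \<rho>, Bot) \<in> H}"

definition proves_safety ::
  "('f, 'r, 'g, 's, 'd, 'c, 'l) frame \<Rightarrow> ('f, 'r, 't) struct \<Rightarrow>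
   ('f, 'r, 'n, 'd, 'c) program set \<Rightarrow> (('f, 'r, 'n, 'd, 'c) program \<Rightarrow> 'n \<Rightarrow> 't) \<Rightarrow>
   ('g, 's, 't, 'c) triple set \<Rightarrow> bool" where
  "proves_safety F T P e H \<longleftrightarrow>
     (\<forall>h\<in>H. valid_triple F T (universal_sem F T P) h) \<and>
     (\<Union>p\<in>P. map (\<lambda>(\<sigma>, a). (\<sigma>, e p a)) ` error_runs F p) \<subseteq> lang H"


section \<open>Well-definedness of the semantics on a universal structure\<close>

lemma generated_closed:
  assumes "f \<in> fsyms voc" "xs \<in> tuples (generated voc M X) (farity voc f)"
  shows "fint M f xs \<in> generated voc M X"
  using assms by (auto simp: tuples_def intro!: generated.app)

lemma local_iso_comp_inv:
  assumes "local_iso voc M [v] A [a] \<beta>" and "local_iso voc M [v] B [b] \<gamma>"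
  shows "local_iso voc A [a] B [b] (\<gamma> \<circ> inv_into (generated voc M {v}) \<beta>)"
proof -
  let ?N = "generated voc M {v}"
  let ?A = "generated voc A {a}"
  let ?B = "generated voc B {b}"
  let ?i = "inv_into ?N \<beta>"
  have inj: "inj_on \<beta> ?N" and img: "\<beta> ` ?N = ?A" and inj': "inj_on \<gamma> ?N" and img': "\<gamma> ` ?N = ?B"
    and bv: "\<beta> v = a" "\<gamma> v = b" and c: "a \<in> carrier A" "b \<in> carrier B"
    and f1: "\<And>f xs. f \<in> fsyms voc \<Longrightarrow> xs \<in> tuples ?N (farity voc f) \<Longrightarrow>
        \<beta> (fint M f xs) = fint A f (map \<beta> xs)"
    and f2: "\<And>f xs. f \<in> fsyms voc \<Longrightarrow> xs \<in> tuples ?N (farity voc f) \<Longrightarrow>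
        \<gamma> (fint M f xs) = fint B f (map \<gamma> xs)"
    and r1: "\<And>r xs. r \<in> rsyms voc \<Longrightarrow> xs \<in> tuples ?N (rarity voc r) \<Longrightarrow>
        rint M r xs \<longleftrightarrow> rint A r (map \<beta> xs)"
    and r2: "\<And>r xs. r \<in> rsyms voc \<Longrightarrow> xs \<in> tuples ?N (rarity voc r) \<Longrightarrow>
        rint M r xs \<longleftrightarrow> rint B r (map \<gamma> xs)"
    using assms by (auto simp: local_iso_def isomorphism_def embedding_def gen_struct_def)
  have bij: "bij_betw ?i ?A ?N"
    using inj img by (metis bij_betw_imageI bij_betw_inv_into)
  have vN: "v \<in> ?N" by (auto intro: generated.base)
  have iv: "?i a = v" using inj vN bv by (metis inv_into_f_f)
  have tup: "map ?i xs \<in> tuples ?N n \<and> map \<beta> (map ?i xs) = xs" if "xs \<in> tuples ?A n" for xs n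
  proof -
    have "x \<in> ?A \<Longrightarrow> ?i x \<in> ?N \<and> \<beta> (?i x) = x" for x
      using img by (metis f_inv_into_f inv_into_into)
    then show ?thesis using that by (auto simp: tuples_def subset_iff intro!: map_idI)
  qed
  have "(\<gamma> \<circ> ?i) (fint A f xs) = fint B f (map (\<gamma> \<circ> ?i) xs)"
    if "f \<in> fsyms voc" "xs \<in> tuples ?A (farity voc f)" for f xs
  proof -
    let ?ys = "map ?i xs"
    have ys: "?ys \<in> tuples ?N (farity voc f)" "map \<beta> ?ys = xs" using tup that by blast+
    then have "fint A f xs = \<beta> (fint M f ?ys)" using f1[OF that(1) ys(1)] by simp
    moreover have "fint M f ?ys \<in> ?N" using generated_closed that(1) ys(1) by metis
    ultimately have "?i (fint A f xs) = fint M f ?ys" using inj by simp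
    then show ?thesis using f2[OF that(1) ys(1)] by simp
  qed
  moreover have "rint A r xs \<longleftrightarrow> rint B r (map (\<gamma> \<circ> ?i) xs)"
    if "r \<in> rsyms voc" "xs \<in> tuples ?A (rarity voc r)" for r xs
  proof -
    have ys: "map ?i xs \<in> tuples ?N (rarity voc r)" "map \<beta> (map ?i xs) = xs" using tup that by blast+
    show ?thesis using r1[OF that(1) ys(1)] r2[OF that(1) ys(1)] ys(2) by simp
  qed
  moreover have "inj_on (\<gamma> \<circ> ?i) ?A" "(\<gamma> \<circ> ?i) ` ?A = ?B"
    using bij inj' img' by (auto simp: bij_betw_def image_comp[symmetric] simp del: image_comp comp_apply
        intro: comp_inj_on)
  ultimately show ?thesis
    using c bv iv by (auto simp: local_iso_def isomorphism_def embedding_def gen_struct_def)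
qed

lemma pullback_comp_inv:
  fixes \<beta> :: "'a \<Rightarrow> 'b" and \<gamma> :: "'a \<Rightarrow> 'c" and R :: "(('c \<Rightarrow> 'd) \<times> ('c \<Rightarrow> 'd)) set"
  assumes "inj_on \<beta> N" and "\<beta> ` N = A"
  shows "pullback N \<beta> (pullback A (\<gamma> \<circ> inv_into N \<beta>) R) = pullback N \<gamma> R"
proof -
  have "compose N (compose A \<nu> (\<gamma> \<circ> inv_into N \<beta>)) \<beta> = compose N \<nu> \<gamma>" for \<nu> :: "'c \<Rightarrow> 'd"
    using assms by (auto simp: compose_def restrict_def fun_eq_iff)
  then show ?thesis
    by (auto simp: pullback_def image_image case_prod_unfold)
qed

lemma universal_sem_eq:
  assumes "parameterized_program F P" "\<sigma> \<in> commands F" "p \<in> P" "u \<in> carrier (topology p)"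
    and \<beta>: "local_iso (node_voc F) T [v] (topology p) [u] \<beta>"
  shows "universal_sem F T P \<sigma> v = pullback (gen F T {v}) \<beta> (sem p \<sigma> u)"
proof -
  have "pullback (gen F T {v}) \<gamma> (sem q \<sigma> w) = pullback (gen F T {v}) \<beta> (sem p \<sigma> u)"
    if q: "q \<in> P" "w \<in> carrier (topology q)"
      and \<gamma>: "local_iso (node_voc F) T [v] (topology q) [w] \<gamma>" for q w \<gamma>
  proof -
    have "sem p \<sigma> u = pullback (gen F (topology p) {u}) (\<gamma> \<circ> inv_into (gen F T {v}) \<beta>) (sem q \<sigma> w)"
      using assms(1-4) q local_iso_comp_inv[OF \<beta> \<gamma>] unfolding parameterized_program_def by blast
    moreover have "inj_on \<beta> (gen F T {v})" "\<beta> ` gen F T {v} = gen F (topology p) {u}"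
      using \<beta> by (auto simp: local_iso_def isomorphism_def embedding_def gen_struct_def)
    ultimately show ?thesis by (simp add: pullback_comp_inv)
  qed
  then show ?thesis
    unfolding universal_sem_def using assms(3-5) by blast
qed

lemma universal_sem_empty:
  assumes "\<not> (\<exists>p\<in>P. \<exists>u\<in>carrier (topology p). \<exists>\<beta>.
    local_iso (node_voc F) T [v] (topology p) [u] \<beta>)"
  shows "universal_sem F T P \<sigma> v = {}"
  using assms by (auto simp: universal_sem_def)

end

theory Submission
  imports Defs
begin

text \<open>An error run of a subprogram is an error run of the ambient program: extend the location
  maps by the initial location. Conversely, a feasible run of the subprogram stays feasible in the
  ambient program, because its valuations can be extended by constant data on the remaining nodes.
  For proof spaces, a node of a subprogram generates the same substructure as in the ambient
  program, so both families induce the same semantics on the universal structure. The two families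
  may be embedded differently into it, but the two images of a tuple of nodes are locally
  isomorphic, and closure under S-param moves the triple \<open>{\<top>} \<rho> {\<bottom>}\<close> from one image to the other.\<close>

section \<open>Substructures and embeddings\<close>

lemma generated_subset_carrier:
  assumes "wf_struct voc M" "X \<subseteq> carrier M"
  shows "generated voc M X \<subseteq> carrier M"
proof
  fix x assume "x \<in> generated voc M X"
  then show "x \<in> carrier M"
    using assms by induction (auto simp: wf_struct_def tuples_def subset_iff)
qed

lemma embedding_substructure:
  assumes "substructure voc S M" "embedding voc M N h"
  shows "embedding voc S N h"
proof -
  have "tuples (carrier S) n \<subseteq> tuples (carrier M) n" for n
    using assms(1) by (auto simp: tuples_def substructure_def)
  then show ?thesis
    using assms unfolding substructure_def embedding_def
    by (auto intro: inj_on_subset simp: subset_iff)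
qed

text \<open>Both inclusions are inductions on generation, since \<open>h\<close> commutes with the
  function symbols on tuples over the carrier.\<close>

lemma generated_embedding:
  assumes M: "wf_struct voc M" and h: "embedding voc M N h" and X: "X \<subseteq> carrier M"
  shows "generated voc N (h ` X) = h ` generated voc M X"
proof
  have sub: "generated voc M X \<subseteq> carrier M" by (rule generated_subset_carrier[OF M X])
  show "h ` generated voc M X \<subseteq> generated voc N (h ` X)"
  proof
    fix y assume "y \<in> h ` generated voc M X"
    then obtain x where x: "x \<in> generated voc M X" and y: "y = h x" by blast
    from x have "h x \<in> generated voc N (h ` X)"
    proof induction
      case (base x) then show ?case by (auto intro: generated.base)
    next
      case (app f xs)
      then have "xs \<in> tuples (carrier M) (farity voc f)" using sub by (auto simp: tuples_def)
      then have "h (fint M f xs) = fint N f (map h xs)"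
        using h app.hyps(1) by (auto simp: embedding_def)
      then show ?case using app.hyps app.IH by (auto intro!: generated.app)
    qed
    then show "y \<in> generated voc N (h ` X)" using y by simp
  qed
  show "generated voc N (h ` X) \<subseteq> h ` generated voc M X"
  proof
    fix y assume "y \<in> generated voc N (h ` X)"
    then show "y \<in> h ` generated voc M X"
    proof induction
      case (base y) then show ?case by (auto intro: generated.base)
    next
      case (app f ys)
      \<comment> \<open>A preimage chosen for each argument gives a single tuple \<open>xs\<close>
        over the set generated in \<open>M\<close>, to which closure applies.\<close>
      then have "ys \<in> lists (h ` generated voc M X)" by auto
      then obtain xs where xs: "set xs \<subseteq> generated voc M X" "ys = map h xs"
        by (auto simp: lists_image)
      then have "xs \<in> tuples (carrier M) (farity voc f)" using sub app by (auto simp: tuples_def)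
      then have "h (fint M f xs) = fint N f ys"
        using h app.hyps(1) xs(2) by (auto simp: embedding_def)
      moreover have "fint M f xs \<in> generated voc M X"
        using app xs by (auto intro!: generated.app)
      ultimately show ?case by (metis imageI)
    qed
  qed
qed

text \<open>Treats the inclusion as an embedding, so that the facts on embeddings specialise to
  substructures.\<close>

lemma substructure_imp_embedding_id:
  assumes "substructure voc S M"
  shows "embedding voc S M id"
  using assms by (auto simp: substructure_def embedding_def)

lemma generated_substructure:
  assumes "substructure voc S M" "X \<subseteq> carrier S"
  shows "generated voc S X = generated voc M X"
  using generated_embedding[OF _ substructure_imp_embedding_id[OF assms(1)] assms(2)] assms(1)
  by (simp add: substructure_def)

section \<open>Isomorphisms of generated substructures and local isomorphisms\<close>

lemma isomorphism_gen_struct: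
  assumes M: "wf_struct voc M" and h: "embedding voc M N h" and X: "X \<subseteq> carrier M"
  shows "isomorphism voc (gen_struct voc M X) (gen_struct voc N (h ` X)) h"
proof -
  have sub: "generated voc M X \<subseteq> carrier M" by (rule generated_subset_carrier[OF M X])
  then have "tuples (generated voc M X) n \<subseteq> tuples (carrier M) n" for n
    by (auto simp: tuples_def)
  then show ?thesis
    using h inj_on_subset[OF _ sub, of h] generated_embedding[OF assms]
    by (auto simp: isomorphism_def embedding_def gen_struct_def subset_iff)
qed

lemma isomorphism_inv:
  assumes M: "wf_struct voc M" and h: "isomorphism voc M N h"
  shows "isomorphism voc N M (inv_into (carrier M) h)"
proof -
  let ?i = "inv_into (carrier M) h"
  have inj: "inj_on h (carrier M)" and img: "h ` carrier M = carrier N"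
    using h by (auto simp: isomorphism_def embedding_def)
  have bij: "bij_betw ?i (carrier N) (carrier M)"
    using inj img by (metis bij_betw_imageI bij_betw_inv_into)
  have tup: "map ?i xs \<in> tuples (carrier M) n" "map h (map ?i xs) = xs"
    if "xs \<in> tuples (carrier N) n" for xs n
  proof -
    have "x \<in> carrier N \<Longrightarrow> ?i x \<in> carrier M \<and> h (?i x) = x" for x
      using img by (metis f_inv_into_f inv_into_into)
    then show "map ?i xs \<in> tuples (carrier M) n" "map h (map ?i xs) = xs"
      using that by (auto simp: tuples_def subset_iff intro!: map_idI)
  qed
  have "?i (fint N f xs) = fint M f (map ?i xs)"
    if f: "f \<in> fsyms voc" and xs: "xs \<in> tuples (carrier N) (farity voc f)" for f xs
  proof -
    have "h (fint M f (map ?i xs)) = fint N f xs"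
      using h f tup[OF xs] by (auto simp: isomorphism_def embedding_def)
    \<comment> \<open>Closure of \<open>M\<close> puts this value where \<open>inv_into\<close>
      really undoes \<open>h\<close>.\<close>
    moreover have "fint M f (map ?i xs) \<in> carrier M"
      using M f tup(1)[OF xs] by (auto simp: wf_struct_def)
    ultimately show ?thesis using inj by (metis inv_into_f_f)
  qed
  moreover have "rint N r xs \<longleftrightarrow> rint M r (map ?i xs)"
    if "r \<in> rsyms voc" "xs \<in> tuples (carrier N) (rarity voc r)" for r xs
    using h that(1) tup[OF that(2)] by (auto simp: isomorphism_def embedding_def)
  ultimately show ?thesis
    using bij by (auto simp: isomorphism_def embedding_def bij_betw_def)
qed

lemma isomorphism_comp:
  assumes g: "isomorphism voc L M g" and h: "isomorphism voc M N h"
  shows "isomorphism voc L N (h \<circ> g)"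
proof -
  have "map g xs \<in> tuples (carrier M) n" if "xs \<in> tuples (carrier L) n" for xs n
    using g that by (auto simp: tuples_def isomorphism_def)
  moreover have "(\<lambda>x. h (g x)) ` carrier L = carrier N"
    using g h unfolding isomorphism_def by (metis image_image)
  moreover have "inj_on (h \<circ> g) (carrier L)"
    using g h by (auto simp: isomorphism_def embedding_def intro: comp_inj_on)
  ultimately show ?thesis
    using g h unfolding isomorphism_def embedding_def by simp
qed

text \<open>Restricted to the substructure of \<open>M\<close> generated by \<open>vs\<close>,
  \<open>h\<close> and \<open>k\<close> are isomorphisms onto the substructures generated by the two
  images; the witness goes back along \<open>h\<close> and then forward along
  \<open>k\<close>.\<close>

lemma locally_isomorphic_embeddings:
  assumes M: "wf_struct voc M" and h: "embedding voc M T h" and k: "embedding voc M T k"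
    and vs: "set vs \<subseteq> carrier M"
  shows "locally_isomorphic voc T (map h vs) (map k vs)"
proof -
  let ?N = "gen_struct voc M (set vs)"
  let ?i = "inv_into (carrier ?N) h"
  have N: "wf_struct voc ?N"
    using generated_closed by (fastforce simp: wf_struct_def gen_struct_def)
  have iso: "isomorphism voc ?N (gen_struct voc T (h ` set vs)) h"
    "isomorphism voc ?N (gen_struct voc T (k ` set vs)) k"
    using isomorphism_gen_struct[OF M _ vs] h k by auto
  have inj: "inj_on h (carrier ?N)"
    using iso(1) by (simp add: isomorphism_def embedding_def)
  have "?i (h v) = v" if "v \<in> set vs" for v
    using inj that by (auto simp: gen_struct_def intro!: inv_into_f_f generated.base)
  then have "map (k \<circ> ?i) (map h vs) = map k vs" by simp
  moreover have "set (map h vs) \<subseteq> carrier T" "set (map k vs) \<subseteq> carrier T"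
    using h k vs by (auto simp: embedding_def)
  ultimately have "local_iso voc T (map h vs) T (map k vs) (k \<circ> ?i)"
    using isomorphism_comp[OF isomorphism_inv[OF N iso(1)] iso(2)]
    by (simp add: local_iso_def del: map_map)
  then show ?thesis by (auto simp: locally_isomorphic_def)
qed

lemma local_iso_substructure:
  assumes S: "substructure voc S M" and \<beta>: "local_iso voc T vs S us \<beta>"
  shows "local_iso voc T vs M us \<beta>"
proof -
  have us: "set us \<subseteq> carrier S" using \<beta> by (simp add: local_iso_def)
  \<comment> \<open>The two generated structures share a carrier, but as records they may differ in
    their interpretations outside it; \<open>id\<close> bridges them instead of an equality.\<close>
  have "isomorphism voc (gen_struct voc S (set us)) (gen_struct voc M (id ` set us)) id"
    using S isomorphism_gen_struct[OF _ substructure_imp_embedding_id[OF S] us]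
    by (simp add: substructure_def)
  then have "isomorphism voc (gen_struct voc T (set vs)) (gen_struct voc M (set us)) \<beta>"
    using \<beta> isomorphism_comp[of voc _ "gen_struct voc S (set us)" \<beta> _ id]
    by (simp add: local_iso_def)
  then show ?thesis
    using \<beta> S by (auto simp: local_iso_def substructure_def)
qed

section \<open>Runs of subprograms\<close>

lemma error_runs_subprogram:
  assumes sub: "subprogram F q p" and init: "l_init F \<in> locations F"
  shows "error_runs F q \<subseteq> error_runs F p"
proof
  fix \<rho> assume "\<rho> \<in> error_runs F q"
  let ?Q = "carrier (topology q)" and ?P = "carrier (topology p)"
  obtain lm where lm: "\<forall>k\<le>length \<rho>. lm k \<in> ?Q \<rightarrow>\<^sub>E locations F"
      "lm 0 = (\<lambda>v\<in>?Q. l_init F)"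
      "\<forall>k<length \<rho>. loc_step F q (lm k) (\<rho> ! k) (lm (Suc k))"
      "l_err F \<in> lm (length \<rho>) ` ?Q"
    using \<open>\<rho> \<in> error_runs F q\<close> unfolding error_runs_def by blast
  \<comment> \<open>Nodes outside \<open>?Q\<close> never step, so they keep the initial location;
    \<open>restrict\<close> keeps the map extensional on \<open>?P\<close>.\<close>
  define lm' where "lm' k = (\<lambda>v\<in>?P. if v \<in> ?Q then lm k v else l_init F)" for k
  have QP: "?Q \<subseteq> ?P" and cmds: "\<forall>v\<in>?Q. cmds q v = cmds p v"
    using sub by (auto simp: subprogram_def substructure_def)
  have "\<forall>k\<le>length \<rho>. lm' k \<in> ?P \<rightarrow>\<^sub>E locations F"
    using lm(1) init by (auto simp: lm'_def PiE_iff)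
  moreover have "lm' 0 = (\<lambda>v\<in>?P. l_init F)"
    using lm(2) by (auto simp: lm'_def fun_eq_iff)
  moreover have "\<forall>k<length \<rho>. loc_step F p (lm' k) (\<rho> ! k) (lm' (Suc k))"
    using lm(3) QP cmds by (fastforce simp: loc_step_def lm'_def fun_eq_iff split: prod.splits)
  moreover have "l_err F \<in> lm' (length \<rho>) ` ?P"
    using lm(4) QP by (force simp: lm'_def)
  ultimately show "\<rho> \<in> error_runs F p" unfolding error_runs_def by blast
qed

text \<open>The semantics of a subprogram is tied to that of the ambient program at such letters
  only.\<close>

lemma error_runs_letters:
  assumes "wf_program F p" "\<rho> \<in> error_runs F p"
  shows "set \<rho> \<subseteq> commands F \<times> carrier (topology p)"
proof
  fix a assume "a \<in> set \<rho>"
  then obtain k where "k < length \<rho>" "a = \<rho> ! k" by (metis in_set_conv_nth)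
  then obtain lm lm' where "loc_step F p lm a lm'"
    using assms(2) unfolding error_runs_def by blast
  then show "a \<in> commands F \<times> carrier (topology p)"
    using assms(1) by (auto simp: loc_step_def wf_program_def)
qed

section \<open>Feasibility in the ambient program\<close>

text \<open>A step at a node of the subprogram constrains the data on its generated substructure,
  which lies within the subprogram, and freezes the rest; padding every valuation of the run with
  the same \<open>\<kappa>\<close> respects this.\<close>

lemma global_subprogram_extend:
  assumes sub: "subprogram F q p" and \<kappa>: "\<kappa> \<in> valuations F (carrier (topology p))"
    and "set \<rho> \<subseteq> commands F \<times> carrier (topology q)"
    and "(\<nu>, \<nu>') \<in> global F (topology q) (sem q) (carrier (topology q)) \<rho>"
  shows "(override_on \<kappa> \<nu> (carrier (topology q)), override_on \<kappa> \<nu>' (carrier (topology q)))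
    \<in> global F (topology p) (sem p) (carrier (topology p)) \<rho>"
  using assms(3,4)
proof (induction \<rho> arbitrary: \<nu>)
  let ?Q = "carrier (topology q)" and ?P = "carrier (topology p)"
  have S: "substructure (node_voc F) (topology q) (topology p)"
    using sub by (simp add: subprogram_def)
  then have QP: "?Q \<subseteq> ?P" by (simp add: substructure_def)
  have ext: "override_on \<kappa> \<mu> ?Q \<in> valuations F ?P" if "\<mu> \<in> valuations F ?Q" for \<mu>
    using that \<kappa> QP by (auto simp: valuations_def override_on_def PiE_iff extensional_def)
  {
    case Nil
    then show ?case using ext by auto
  next
    case (Cons a \<rho>)
    obtain \<sigma> v where a: "a = (\<sigma>, v)" by (cases a)
    have \<sigma>v: "\<sigma> \<in> commands F" "v \<in> ?Q" using Cons.prems(1) a by auto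
    obtain \<mu> where step: "(\<nu>, \<mu>) \<in> global_step F (topology q) (sem q) ?Q a"
      and rest: "(\<mu>, \<nu>') \<in> global F (topology q) (sem q) ?Q \<rho>"
      using Cons.prems(2) by auto
    let ?N = "gen F (topology q) {v}"
    have gen: "gen F (topology p) {v} = ?N"
      using generated_substructure[OF S, of "{v}"] \<sigma>v(2) by simp
    have "?N \<subseteq> ?Q"
      using generated_subset_carrier[of "node_voc F" "topology q" "{v}"] S \<sigma>v(2)
      by (simp add: substructure_def)
    then have res: "restrict (override_on \<kappa> \<mu>' ?Q) ?N = restrict \<mu>' ?N" for \<mu>'
      by (auto simp: override_on_def restrict_def fun_eq_iff)
    have sem: "sem p \<sigma> v = sem q \<sigma> v" using sub \<sigma>v by (simp add: subprogram_def)
    \<comment> \<open>Outside \<open>?Q\<close> both sides are \<open>\<kappa>\<close>; on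
      \<open>?Q - ?N\<close> the original step changes nothing.\<close>
    have "\<forall>x\<in>?P - ?N. override_on \<kappa> \<nu> ?Q x = override_on \<kappa> \<mu> ?Q x"
      using step by (auto simp: global_step_def a override_on_def)
    then have "(override_on \<kappa> \<nu> ?Q, override_on \<kappa> \<mu> ?Q) \<in> global_step F (topology p) (sem p) ?P a"
      using step ext by (auto simp: global_step_def a gen res sem)
    then show ?case using Cons.IH[OF _ rest] Cons.prems(1) by auto
  }
qed

lemma safe_subprogram:
  assumes sub: "subprogram F q p" and init: "l_init F \<in> locations F"
    and q: "wf_program F q" and safe: "safe F p"
  shows "safe F q"
  unfolding safe_def infeasible_def
proof (intro ballI equals0I, clarify)
  let ?Q = "carrier (topology q)" and ?P = "carrier (topology p)"
  fix \<rho> \<nu> \<nu>'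
  assume \<rho>: "\<rho> \<in> error_runs F q" and \<nu>: "(\<nu>, \<nu>') \<in> global F (topology q) (sem q) ?Q \<rho>"
  \<comment> \<open>The padding needs a datum, and the data domain is not assumed nonempty. An error
    run has a node at \<open>l_err\<close>, so \<open>\<nu>\<close> has a value to offer.\<close>
  obtain v where v: "v \<in> ?Q" using \<rho> by (auto simp: error_runs_def)
  have "\<nu> \<in> valuations F ?Q"
    using \<nu> by (cases \<rho>) (auto simp: global_step_def split: prod.splits)
  then have "\<nu> v \<in> carrier (data F)" using v by (auto simp: valuations_def)
  then have "(\<lambda>_\<in>?P. \<nu> v) \<in> valuations F ?P" by (auto simp: valuations_def)
  from global_subprogram_extend[OF sub this error_runs_letters[OF q \<rho>] \<nu>]
  show False
    using safe error_runs_subprogram[OF sub init] \<rho> by (auto simp: safe_def infeasible_def)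
qed

section \<open>Proof spaces over a universal structure\<close>

text \<open>A contribution of \<open>q\<close> is also one of any program that has \<open>q\<close>
  as a subprogram, with the same \<open>u\<close> and \<open>\<beta>\<close>; the other inclusion is
  monotonicity in the family.\<close>

lemma universal_sem_subprograms:
  assumes "P \<subseteq> P'" "\<forall>q\<in>P'. \<exists>p\<in>P. subprogram F q p" "\<sigma> \<in> commands F"
  shows "universal_sem F T P' \<sigma> v = universal_sem F T P \<sigma> v"
proof
  show "universal_sem F T P \<sigma> v \<subseteq> universal_sem F T P' \<sigma> v"
    using assms(1) unfolding universal_sem_def by blast
  show "universal_sem F T P' \<sigma> v \<subseteq> universal_sem F T P \<sigma> v"
  proof
    fix x assume "x \<in> universal_sem F T P' \<sigma> v"
    then obtain q u \<beta> where q: "q \<in> P'" "u \<in> carrier (topology q)"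
      and \<beta>: "local_iso (node_voc F) T [v] (topology q) [u] \<beta>"
      and x: "x \<in> pullback (gen F T {v}) \<beta> (sem q \<sigma> u)"
      unfolding universal_sem_def by blast
    obtain p where p: "p \<in> P" and sub: "subprogram F q p" using assms(2) q(1) by blast
    have "local_iso (node_voc F) T [v] (topology p) [u] \<beta>"
      using sub local_iso_substructure[OF _ \<beta>] by (simp add: subprogram_def)
    moreover have "u \<in> carrier (topology p)" "sem q \<sigma> u = sem p \<sigma> u"
      using sub q(2) assms(3) by (auto simp: subprogram_def substructure_def)
    ultimately show "x \<in> universal_sem F T P \<sigma> v"
      unfolding universal_sem_def using p x by auto
  qed
qed

lemma global_cong:
  assumes "\<And>\<sigma> v. (\<sigma>, v) \<in> set \<rho> \<Longrightarrow> s \<sigma> v = s' \<sigma> v"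
  shows "global F M s V \<rho> = global F M s' V \<rho>"
  using assms
proof (induction \<rho>)
  case (Cons a \<rho>)
  have "global_step F M s V a = global_step F M s' V a"
    using Cons.prems by (cases a) (simp add: global_step_def)
  then show ?case using Cons by simp
qed simp

text \<open>Words of triples use commands of the frame only, which is where the two universal
  semantics are known to agree.\<close>

lemma valid_triple_cong:
  assumes "h \<in> triples F T" "\<And>\<sigma> v. \<sigma> \<in> commands F \<Longrightarrow> s \<sigma> v = s' \<sigma> v"
  shows "valid_triple F T s h = valid_triple F T s' h"
proof -
  obtain A \<rho> B where h: "h = (A, \<rho>, B)" by (cases h)
  have "global F T s V \<rho> = global F T s' V \<rho>" for V
    using assms by (intro global_cong) (auto simp: h triples_def)
  then show ?thesis by (simp add: h valid_triple_def)
qed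

section \<open>Transfer of proofs between embeddings\<close>

text \<open>S-param with empty tuples for the assertions: \<open>Top\<close> and \<open>Bot\<close>
  have no free variables, so only the nodes of the word must be locally isomorphic.\<close>

lemma lang_locally_isomorphic:
  assumes H: "proof_space F T H" and \<rho>: "map (\<lambda>(\<sigma>, a). (\<sigma>, h a)) \<rho> \<in> lang H"
    and iso: "locally_isomorphic (node_voc F) T (map h (map snd \<rho>)) (map k (map snd \<rho>))"
  shows "map (\<lambda>(\<sigma>, a). (\<sigma>, k a)) \<rho> \<in> lang H"
proof -
  \<comment> \<open>Splits the word into commands and nodes, the shape that S-param expects.\<close>
  have zip: "map (\<lambda>(\<sigma>, a). (\<sigma>, g a)) \<rho> = zip (map fst \<rho>) (map g (map snd \<rho>))" for g
    by (induction \<rho>) auto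
  have closed: "closed_s_param (node_voc F) T H" using H by (simp add: proof_space_def)
  have "(inst Top [], zip (map fst \<rho>) (map h (map snd \<rho>)), inst Bot []) \<in> H"
    using \<rho> by (simp only: zip) (simp add: lang_def inst_def)
  then have "(inst Top [], zip (map fst \<rho>) (map k (map snd \<rho>)), inst Bot []) \<in> H"
    using closed[unfolded closed_s_param_def, rule_format, of Top "[]" "map fst \<rho>"
        "map h (map snd \<rho>)" Bot "[]" "[]" "map k (map snd \<rho>)" "[]"] iso by simp
  then show ?thesis by (simp only: zip) (simp add: lang_def inst_def)
qed

lemma lang_embeddings:
  assumes H: "proof_space F T H" and q: "wf_program F q" and \<rho>: "\<rho> \<in> error_runs F q"
    and h: "embedding (node_voc F) (topology q) T h" and k: "embedding (node_voc F) (topology q) T k"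
    and "map (\<lambda>(\<sigma>, a). (\<sigma>, h a)) \<rho> \<in> lang H"
  shows "map (\<lambda>(\<sigma>, a). (\<sigma>, k a)) \<rho> \<in> lang H"
proof (rule lang_locally_isomorphic[OF H assms(6)])
  have "set (map snd \<rho>) \<subseteq> carrier (topology q)" using error_runs_letters[OF q \<rho>] by auto
  then show "locally_isomorphic (node_voc F) T (map h (map snd \<rho>)) (map k (map snd \<rho>))"
    using q h k by (intro locally_isomorphic_embeddings) (auto simp: wf_program_def)
qed

theorem theorem6p11:
  fixes F :: "('f, 'r, 'g, 's, 'd, 'c, 'l) frame"
    and P P' :: "('f, 'r, 'n, 'd, 'c) program set"
  assumes "wf_frame F"
    and "parameterized_program F P"
    and "parameterized_program F P'"
    and "P \<subseteq> P'"
    and "\<forall>q\<in>P'. \<exists>p\<in>P. subprogram F q p"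
  shows "(safe_family F P \<longleftrightarrow> safe_family F P') \<and>
    (\<forall>(T :: ('f, 'r, 't) struct) e e' H.
       universal_structure F T P e \<and> universal_structure F T P' e' \<and> proof_space F T H \<longrightarrow>
       (proves_safety F T P e H \<longleftrightarrow> proves_safety F T P' e' H))"
proof (intro conjI allI impI)
  have init: "l_init F \<in> locations F" using assms(1) by (simp add: wf_frame_def)
  have wf: "wf_program F q" if "q \<in> P'" for q
    using assms(3) that by (simp add: parameterized_program_def)
  show "safe_family F P \<longleftrightarrow> safe_family F P'"
    using assms(4,5) safe_subprogram[OF _ init wf] unfolding safe_family_def by blast
  fix T :: "('f, 'r, 't) struct" and e e' H
  assume "universal_structure F T P e \<and> universal_structure F T P' e' \<and> proof_space F T H"
  then have H: "proof_space F T H"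
    and e: "\<And>p. p \<in> P \<Longrightarrow> embedding (node_voc F) (topology p) T (e p)"
    and e': "\<And>q. q \<in> P' \<Longrightarrow> embedding (node_voc F) (topology q) T (e' q)"
    by (auto simp: universal_structure_def)
  \<comment> \<open>Validity of \<open>H\<close> thus means the same for both families, and only the
    inclusions of error runs in \<open>lang H\<close> remain.\<close>
  have "valid_triple F T (universal_sem F T P) h = valid_triple F T (universal_sem F T P') h"
    if "h \<in> H" for h
  proof (rule valid_triple_cong)
    show "h \<in> triples F T" using H that by (auto simp: proof_space_def)
  qed (rule universal_sem_subprograms[OF assms(4,5), symmetric])
  moreover have "map (\<lambda>(\<sigma>, a). (\<sigma>, e p a)) \<rho> \<in> lang H"
    if runs: "(\<Union>q\<in>P'. map (\<lambda>(\<sigma>, a). (\<sigma>, e' q a)) ` error_runs F q) \<subseteq> lang H"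
      and p: "p \<in> P" and \<rho>: "\<rho> \<in> error_runs F p" for p \<rho>
  proof -
    \<comment> \<open>As a member of both families, \<open>p\<close> has the two embeddings
      \<open>e p\<close> and \<open>e' p\<close>, which may differ.\<close>
    have "p \<in> P'" using p assms(4) by blast
    then show ?thesis
      using lang_embeddings[OF H wf \<rho> e' e[OF p]] runs \<rho> by blast
  qed
  moreover have "map (\<lambda>(\<sigma>, a). (\<sigma>, e' q a)) \<rho> \<in> lang H"
    if runs: "(\<Union>p\<in>P. map (\<lambda>(\<sigma>, a). (\<sigma>, e p a)) ` error_runs F p) \<subseteq> lang H"
      and q: "q \<in> P'" and \<rho>: "\<rho> \<in> error_runs F q" for q \<rho>
  proof -
    obtain p where p: "p \<in> P" and sub: "subprogram F q p" using assms(5) q by blast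
    \<comment> \<open>Restricting \<open>e p\<close> gives a second embedding of \<open>q\<close>
      next to \<open>e' q\<close>.\<close>
    then have "embedding (node_voc F) (topology q) T (e p)"
      using embedding_substructure[OF _ e] by (simp add: subprogram_def)
    moreover have "map (\<lambda>(\<sigma>, a). (\<sigma>, e p a)) \<rho> \<in> lang H"
      using runs p \<rho> error_runs_subprogram[OF sub init] by blast
    ultimately show ?thesis using lang_embeddings[OF H wf[OF q] \<rho> _ e'[OF q]] by blast
  qed
  ultimately show "proves_safety F T P e H \<longleftrightarrow> proves_safety F T P' e' H"
    unfolding proves_safety_def by blast
qed

end
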